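(* Let $M$ be a (not necessarily metrisable) manifold of dimension at least $2$ and let $\mathcal F$ be a dimension-one foliation on $M$. Then the set of leaves of $\mathcal F$ has cardinality exactly $\mathfrak c=\mathrm{card}(\mathbb R)$.
   Context: Manifold: a non-empty, connected, Hausdorff space in which every point has a neighbourhood homeomorphic to $\mathbb R^n$, for a fixed $n$ (metrisability is not assumed). Foliation: a foliation $\mathcal F$ of dimension $p$ (codimension $n-p$) on an $n$-manifold $M$ is a maximal atlas $\{(U_i,\varphi_i)\}_{i\in I}$ on $M$ such that all coordinate changes have the form $\varphi_j\varphi_i^{-1}(x,y)=(g_{i,j}(x,y),h_{i,j}(y))$ for $(x,y)\in\varphi_i(U_i\cap U_j)\subset\mathbb R^p\times\mathbb R^{n-p}$, where $g_{i,j}:\varphi_i(U_i\cap U_j)\to\mathbb R^p$ and $h_{i,j}$ is an embedding of a relevant open subset of $\mathbb R^{n-p}$ into $\mathbb R^{n-p}$ (only continuity is required). Its charts are called foliated charts; components of the sets $\varphi_i^{-1}(\mathbb R^p\times\{y\})$ are called plaques. The plaques form a basis of a new topology on $M$ (the leaf topology), whose path components, injectively immersed $p$-manifolds, are the leaves of $\mathcal F$. *)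

theory Defs
  imports "HOL-Analysis.Analysis"
begin

definition manifold :: "nat \<Rightarrow> 'a topology \<Rightarrow> bool" where
  "manifold n M \<longleftrightarrow>
     topspace M \<noteq> {} \<and> connected_space M \<and> Hausdorff_space M \<and>
     (\<forall>x \<in> topspace M. \<exists>N. openin M N \<and> x \<in> N \<and>
        subtopology M N homeomorphic_space Euclidean_space n)"

abbreviation split_Euclidean_space ::
    "nat \<Rightarrow> nat \<Rightarrow> ((nat \<Rightarrow> real) \<times> (nat \<Rightarrow> real)) topology" where
  "split_Euclidean_space n p \<equiv> prod_topology (Euclidean_space p) (Euclidean_space (n - p))"

text \<open>
  A chart is a pair of an open set and a map, which is a homeomorphism from this set onto an open
  subset of \<open>\<real>\<^sup>p \<times> \<real>\<^sup>n\<^sup>-\<^sup>p\<close>. As the map is only relevant on the domain of the chart, it is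
  normalised to \<^const>\<open>undefined\<close> elsewhere.
\<close>

type_synonym 'a chart = "'a set \<times> ('a \<Rightarrow> (nat \<Rightarrow> real) \<times> (nat \<Rightarrow> real))"

definition split_chart :: "nat \<Rightarrow> nat \<Rightarrow> 'a topology \<Rightarrow> 'a chart \<Rightarrow> bool" where
  "split_chart n p M = (\<lambda>(U, \<phi>).
     openin M U \<and> \<phi> \<in> extensional U \<and>
     openin (split_Euclidean_space n p) (\<phi> ` U) \<and>
     homeomorphic_map (subtopology M U) (subtopology (split_Euclidean_space n p) (\<phi> ` U)) \<phi>)"

definition foliated_change :: "nat \<Rightarrow> nat \<Rightarrow> 'a chart \<Rightarrow> 'a chart \<Rightarrow> bool" where
  "foliated_change n p = (\<lambda>(U, \<phi>) (V, \<psi>). \<exists>g h.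
     continuous_map (subtopology (split_Euclidean_space n p) (\<phi> ` (U \<inter> V))) (Euclidean_space p) g \<and>
     embedding_map (subtopology (Euclidean_space (n - p)) (snd ` \<phi> ` (U \<inter> V)))
       (Euclidean_space (n - p)) h \<and>
     (\<forall>(x, y) \<in> \<phi> ` (U \<inter> V). \<psi> (inv_into U \<phi> (x, y)) = (g (x, y), h y)))"

definition foliated_atlas :: "nat \<Rightarrow> nat \<Rightarrow> 'a topology \<Rightarrow> 'a chart set \<Rightarrow> bool" where
  "foliated_atlas n p M A \<longleftrightarrow>
     (\<forall>c \<in> A. split_chart n p M c) \<and> (\<Union>(U, \<phi>) \<in> A. U) = topspace M \<and>
     (\<forall>c \<in> A. \<forall>d \<in> A. foliated_change n p c d)"

definition foliation :: "nat \<Rightarrow> nat \<Rightarrow> 'a topology \<Rightarrow> 'a chart set \<Rightarrow> bool" where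
  "foliation n p M F \<longleftrightarrow>
     p \<le> n \<and> foliated_atlas n p M F \<and>
     (\<forall>A. foliated_atlas n p M A \<longrightarrow> F \<subseteq> A \<longrightarrow> A = F)"

definition plaques :: "'a topology \<Rightarrow> 'a chart set \<Rightarrow> 'a set set" where
  "plaques M F =
     (\<Union>(U, \<phi>) \<in> F. \<Union>y. connected_components_of (subtopology M {z \<in> U. snd (\<phi> z) = y}))"

text \<open>
  A foliation contains the restrictions of its charts to open subsets, so its plaques are not only
  a subbasis but a basis of the topology they generate.
\<close>

definition leaf_topology :: "'a topology \<Rightarrow> 'a chart set \<Rightarrow> 'a topology" where
  "leaf_topology M F = topology_generated_by (plaques M F)"

definition leaves :: "'a topology \<Rightarrow> 'a chart set \<Rightarrow> 'a set set" where
  "leaves M F = path_components_of (leaf_topology M F)"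

end

theory Submission
  imports Defs
begin

text \<open>
  Upper bound: a connected Hausdorff manifold has at most continuum many points, since closing up
  a point under charts and sequential limits yields a clopen set.

  Lower bound: take a compact arc \<open>T\<close> transverse to the leaves in a foliated chart. In the leaf
  topology, a Hausdorff 1-manifold, \<open>T\<close> is closed and discrete, so a compact set meets it in
  finitely many points. Suppose that some leaf meets \<open>T\<close> in an uncountable set, and join a base
  point \<open>x\<close> of the leaf to every \<open>z\<close> in this set by an arc \<open>A\<^sub>z\<close>. As every \<open>A\<^sub>z\<close> contains only
  finitely many points of \<open>T\<close>, there are three points none of which lies on the arc of another.
  Their arcs form a triod with centre \<open>x\<close>, which does not exist in a 1-manifold. Hence every leaf
  meets \<open>T\<close> in a countable set (even if it is a long line), and there are at least as many leaves
  as points of \<open>T\<close>.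
\<close>

section \<open>Cardinality of manifolds\<close>

text \<open>A set-valued function on a countable type is determined by its graph, a subset of a
  countable type of pairs, which \<open>to_nat\<close> turns into a single set of naturals.\<close>

lemma lepoll_nat_set_nat_fun:
  fixes A :: "('i::countable \<Rightarrow> nat set) set"
  shows "A \<lesssim> (UNIV :: nat set set)"
proof -
  define J where "J f = to_nat ` {(i, k). k \<in> f i}" for f :: "'i \<Rightarrow> nat set"
  have "k \<in> f i \<longleftrightarrow> to_nat (i, k) \<in> J f" for f i k
    by (auto simp: J_def)
  then have "inj J"
    by (intro injI ext set_eqI) blast
  then show ?thesis
    by (meson lepoll_def inj_on_subset subset_UNIV)
qed

lemma Euclidean_space_lepoll_nat_sets: "topspace (Euclidean_space n) \<lesssim> (UNIV :: nat set set)"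
proof -
  obtain j :: "real \<Rightarrow> nat set" where "inj j"
    using nat_sets_eqpoll_reals eqpoll_sym unfolding eqpoll_def bij_betw_def by metis
  then have "inj ((\<circ>) j :: (nat \<Rightarrow> real) \<Rightarrow> _)"
    by (auto intro!: injI simp: fun_eq_iff inj_eq)
  then have "(UNIV :: (nat \<Rightarrow> real) set) \<lesssim> (UNIV :: (nat \<Rightarrow> nat set) set)"
    by (auto simp: lepoll_def)
  then show ?thesis
    by (meson lepoll_nat_set_nat_fun lepoll_trans subset_UNIV subset_imp_lepoll)
qed

lemma metrizable_Euclidean_space: "metrizable_space (Euclidean_space n)"
  unfolding Euclidean_space_def
  unfolding euclidean_product_topology
  by (intro metrizable_space_subtopology metrizable_space_euclidean)

text \<open>Closures can be computed inside the open set \<open>N\<close>, where the metric supplies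
  a sequence; its limit in \<open>N\<close> is also its limit in the whole space.\<close>

lemma in_closure_of_sequentially:
  assumes N: "openin X N" "x \<in> N" "metrizable_space (subtopology X N)" and x: "x \<in> X closure_of S"
  obtains \<sigma> :: "nat \<Rightarrow> 'a" where "range \<sigma> \<subseteq> S" "limitin X \<sigma> x sequentially"
proof -
  obtain C d where "Metric_space C d" and top: "subtopology X N = Metric_space.mtopology C d"
    using N(3) unfolding metrizable_space_def by blast
  then interpret Metric_space C d by simp
  have "x \<in> mtopology closure_of S"
    unfolding top[symmetric] using N x closure_of_subtopology_open[of X N S] by blast
  then obtain \<sigma> :: "nat \<Rightarrow> 'a" where "range \<sigma> \<subseteq> S" "limitin (subtopology X N) \<sigma> x sequentially"
    unfolding top closure_of_sequentially by blast
  then show ?thesis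
    using that by (auto simp: limitin_subtopology)
qed

text \<open>
  The points reachable from a base point by passing to a point of a chart or to the limit of a
  sequence form a clopen set. They are named by well-founded trees, which are coded by their
  labels along finite paths; so no transfinite iteration is needed to count them. The point
  named by a \<open>Limit\<close> term is a junk value if the sequence does not converge.
\<close>

datatype point_term = Root | Chart point_term "nat set" | Limit "nat \<Rightarrow> point_term"

text \<open>The label at \<open>[]\<close> tells the constructors apart: it is empty for
  \<open>Root\<close>, contains \<open>0\<close> for \<open>Chart\<close> and is
  \<open>{Suc 0}\<close> for \<open>Limit\<close>. The shift by \<open>Suc\<close> keeps
  \<open>A\<close> recoverable next to the marker \<open>0\<close>. Below a \<open>Chart\<close> the
  first path entry is ignored, as there is only one subterm.\<close>

primrec term_code :: "point_term \<Rightarrow> nat list \<Rightarrow> nat set" where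
  "term_code Root = (\<lambda>_. {})"
| "term_code (Chart t A) = (\<lambda>l. case l of [] \<Rightarrow> insert 0 (Suc ` A) | _ # l' \<Rightarrow> term_code t l')"
| "term_code (Limit f) = (\<lambda>l. case l of [] \<Rightarrow> {Suc 0} | k # l' \<Rightarrow> term_code (f k) l')"

lemma inj_term_code: "inj term_code"
proof (rule injI)
  fix s t assume "term_code s = term_code t"
  then show "s = t"
  proof (induction s arbitrary: t)
    case Root
    from fun_cong[OF Root, of "[]"] show ?case by (cases t) auto
  next
    case (Chart s A)
    note eq = fun_cong[OF Chart.prems]
    from eq[of "[]"] obtain t' B where t: "t = Chart t' B" by (cases t) auto
    have "A = B"
      using eq[of "[]"] inj_image_eq_iff[OF inj_Suc, of A B] unfolding t by (auto 0 3 dest: equalityD1 equalityD2)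
    moreover have "term_code s = term_code t'"
      using eq[of "undefined # l" for l] t by (auto simp: fun_eq_iff)
    ultimately show ?case
      using Chart.IH t by simp
  next
    case (Limit f)
    note eq = fun_cong[OF Limit.prems]
    from eq[of "[]"] obtain g where t: "t = Limit g" by (cases t) auto
    have "f k = g k" for k
      using eq[of "k # l" for l] t Limit.IH[of "f k" "g k"] by (auto simp: fun_eq_iff)
    then show ?case
      using t by auto
  qed
qed

lemma point_term_lepoll: "(A :: point_term set) \<lesssim> (UNIV :: nat set set)"
proof -
  have "A \<lesssim> (UNIV :: (nat list \<Rightarrow> nat set) set)"
    unfolding lepoll_def by (meson inj_term_code inj_on_subset subset_UNIV)
  then show ?thesis
    by (meson lepoll_nat_set_nat_fun lepoll_trans)
qed

text \<open>In use, \<open>e y\<close> enumerates a neighbourhood of \<open>y\<close> by sets of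
  naturals, so a \<open>Chart\<close> term can name any point near the one named by its
  subterm.\<close>

primrec term_point :: "'a topology \<Rightarrow> ('a \<Rightarrow> nat set \<Rightarrow> 'a) \<Rightarrow> 'a \<Rightarrow> point_term \<Rightarrow> 'a" where
  "term_point X e x Root = x"
| "term_point X e x (Chart t A) = e (term_point X e x t) A"
| "term_point X e x (Limit f) = (THE l. limitin X (\<lambda>k. term_point X e x (f k)) l sequentially)"

lemma connected_space_lepoll_reals:
  assumes "connected_space X" "Hausdorff_space X"
    and nbhd: "\<And>x. x \<in> topspace X \<Longrightarrow> \<exists>N. openin X N \<and> x \<in> N \<and> metrizable_space (subtopology X N) \<and>
                 N \<lesssim> (UNIV :: nat set set)"
  shows "topspace X \<lesssim> (UNIV :: real set)"
proof (cases "topspace X = {}")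
  case False
  then obtain x0 where x0: "x0 \<in> topspace X" by blast
  from nbhd obtain N where N: "\<And>x. x \<in> topspace X \<Longrightarrow> openin X (N x) \<and> x \<in> N x \<and>
      metrizable_space (subtopology X (N x)) \<and> N x \<lesssim> (UNIV :: nat set set)"
    by metis
  then obtain e :: "'a \<Rightarrow> nat set \<Rightarrow> 'a" where e: "\<And>x. x \<in> topspace X \<Longrightarrow> N x \<subseteq> range (e x)"
    unfolding lepoll_iff by metis
  \<comment> \<open>The intersection discards junk: \<open>e x\<close> may take values outside the
    space, and so may a \<open>Limit\<close> term without a limit.\<close>
  define S where "S = topspace X \<inter> range (term_point X e x0)"
  \<comment> \<open>One more \<open>Chart\<close> step reaches all of \<open>N x\<close>, which
    makes \<open>S\<close> open.\<close>
  have S: "N x \<subseteq> S" if xS: "x \<in> S" for x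
  proof
    fix y assume y: "y \<in> N x"
    obtain t where t: "x = term_point X e x0 t" and x: "x \<in> topspace X"
      using xS unfolding S_def by blast
    obtain A where "y = e x A" using e[OF x] y by blast
    then have "y = term_point X e x0 (Chart t A)" using t by simp
    then have "y \<in> range (term_point X e x0)" by (rule range_eqI)
    then show "y \<in> S" using y N[OF x] openin_subset unfolding S_def by blast
  qed
  have "openin X S"
    using S N by (subst openin_subopen) (metis IntD1 S_def)
  moreover have "closedin X S"
  proof -
    have "x \<in> S" if x: "x \<in> X closure_of S" for x
    proof -
      have xX: "x \<in> topspace X" using x by (meson closure_of_subset_topspace subsetD)
      obtain \<sigma> where \<sigma>: "range \<sigma> \<subseteq> S" "limitin X \<sigma> x sequentially"
        using in_closure_of_sequentially[of X "N x" x S] N[OF xX] x by blast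
      have "\<forall>k. \<exists>t. \<sigma> k = term_point X e x0 t" using \<sigma>(1) unfolding S_def by blast
      then obtain f where f: "\<And>k. \<sigma> k = term_point X e x0 (f k)" by metis
      then have "limitin X (\<lambda>k. term_point X e x0 (f k)) x sequentially" using \<sigma>(2) by (metis (no_types) ext)
      \<comment> \<open>Limits are unique in a Hausdorff space, so the definite description
        evaluates to \<open>x\<close>.\<close>
      then have "term_point X e x0 (Limit f) = x"
        by (auto intro!: the_equality dest: limitin_Hausdorff_unique[OF _ _ _ \<open>Hausdorff_space X\<close>])
      then show ?thesis using xX unfolding S_def by (metis IntI rangeI)
    qed
    then show ?thesis
      by (metis S_def closure_of_eq closure_of_subset inf_le1 subsetI subset_antisym)
  qed
  moreover have "x0 \<in> S" using x0 unfolding S_def by (metis IntI rangeI term_point.simps(1))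
  ultimately have "topspace X = S"
    using \<open>connected_space X\<close> by (metis connected_space_clopen_in empty_iff)
  then have "topspace X \<lesssim> range (term_point X e x0)"
    by (metis S_def inf_le2 subset_imp_lepoll)
  also have "\<dots> \<lesssim> (UNIV :: point_term set)" by (rule image_lepoll)
  also have "\<dots> \<lesssim> (UNIV :: nat set set)" by (rule point_term_lepoll)
  also have "\<dots> \<approx> (UNIV :: real set)" by (rule nat_sets_eqpoll_reals)
  finally show ?thesis .
qed simp

lemma manifold_lepoll_reals:
  assumes "manifold n M"
  shows "topspace M \<lesssim> (UNIV :: real set)"
proof (rule connected_space_lepoll_reals)
  show "connected_space M" "Hausdorff_space M" using assms by (auto simp: manifold_def)
  fix x assume "x \<in> topspace M"
  then obtain N where N: "openin M N" "x \<in> N" "subtopology M N homeomorphic_space Euclidean_space n"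
    using assms unfolding manifold_def by blast
  have "metrizable_space (subtopology M N)"
    using N(3) metrizable_Euclidean_space homeomorphic_metrizable_space by blast
  moreover have "N \<lesssim> (UNIV :: nat set set)"
  proof -
    obtain f where f: "homeomorphic_map (subtopology M N) (Euclidean_space n) f"
      using N(3) unfolding homeomorphic_space by blast
    have "topspace (subtopology M N) = N" using openin_subset[OF N(1)] by (rule topspace_subtopology_subset)
    then have "inj_on f N" "f ` N = topspace (Euclidean_space n)"
      using homeomorphic_imp_injective_map[OF f] homeomorphic_imp_surjective_map[OF f] by simp_all
    then have "N \<lesssim> topspace (Euclidean_space n)" unfolding lepoll_def by blast
    then show ?thesis using Euclidean_space_lepoll_nat_sets lepoll_trans by blast
  qed
  ultimately show "\<exists>N. openin M N \<and> x \<in> N \<and> metrizable_space (subtopology M N) \<and> N \<lesssim> (UNIV :: nat set set)"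
    using N by blast
qed

section \<open>Arcs in one-dimensional manifolds\<close>

text \<open>A free set of size three for a set mapping with finite values. Reserves are fixed first:
  an infinite countable \<open>S\<close>, an infinite countable \<open>R\<close> outside all values
  on \<open>S\<close>, and a point \<open>c\<close> outside all values on \<open>S\<close> and
  \<open>R\<close>. Then \<open>b\<close> in \<open>R\<close> and \<open>a\<close> in
  \<open>S\<close> are picked in reverse order, each avoiding only finitely many points.\<close>

lemma uncountable_finite_set_mapping_free_triple:
  assumes Z: "uncountable Z" and fin: "\<And>z. z \<in> Z \<Longrightarrow> finite (f z \<inter> Z)"
  obtains a b c where "a \<in> Z" "b \<in> Z" "c \<in> Z"
    "a \<notin> f b" "a \<notin> f c" "b \<notin> f a" "b \<notin> f c" "c \<notin> f a" "c \<notin> f b"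
proof -
  have uncountable: "uncountable (Z - (\<Union>z\<in>S. f z))" if "S \<subseteq> Z" "countable S" for S
  proof -
    have "countable (\<Union>z\<in>S. f z \<inter> Z)"
      using that fin by (intro countable_UN) (auto intro: countable_finite)
    then have "uncountable (Z - (\<Union>z\<in>S. f z \<inter> Z))"
      using Z by (simp add: uncountable_minus_countable)
    moreover have "Z - (\<Union>z\<in>S. f z \<inter> Z) = Z - (\<Union>z\<in>S. f z)" by blast
    ultimately show ?thesis by simp
  qed
  obtain S where S: "S \<subseteq> Z" "countable S" "infinite S"
    using Z by (meson infinite_countable_subset' countable_finite)
  obtain R where R: "R \<subseteq> Z - (\<Union>z\<in>S. f z)" "countable R" "infinite R"
    using uncountable[OF S(1,2)] by (meson infinite_countable_subset' countable_finite)
  have "uncountable (Z - (\<Union>z\<in>S \<union> R. f z))"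
    using uncountable[of "S \<union> R"] S R by blast
  then obtain c where c: "c \<in> Z" "c \<notin> (\<Union>z\<in>S \<union> R. f z)"
    by (metis DiffE countable_empty equals0I)
  have "infinite (R - f c \<inter> Z)" using R fin[OF c(1)] by simp
  then obtain b where "b \<in> R - f c \<inter> Z" using infinite_imp_nonempty by blast
  then have b: "b \<in> R" "b \<notin> f c" using R(1) by blast+
  have "b \<in> Z" using b R by blast
  then have "infinite (S - (f c \<inter> Z) - (f b \<inter> Z))" using S fin[OF c(1)] fin[of b] by simp
  then obtain a where "a \<in> S - (f c \<inter> Z) - (f b \<inter> Z)" using infinite_imp_nonempty by blast
  then have a: "a \<in> S" "a \<notin> f c" "a \<notin> f b" using S(1) by blast+
  show ?thesis
    by (rule that[of a b c]) (use a b c R S in auto)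
qed

text \<open>The case \<open>b = 0\<close> of a constant arc is deliberately allowed.\<close>

definition arcin :: "'a topology \<Rightarrow> real \<Rightarrow> (real \<Rightarrow> 'a) \<Rightarrow> bool" where
  "arcin X b g \<longleftrightarrow> 0 \<le> b \<and> continuous_map (top_of_set {0..b}) X g \<and> inj_on g {0..b}"

lemma arcin_restrict:
  assumes "arcin X b g" "0 \<le> c" "c \<le> b"
  shows "arcin X c g"
proof -
  have "{0..c} \<subseteq> {0..b}" using assms by simp
  then show ?thesis
    using assms continuous_map_from_subtopology_mono inj_on_subset unfolding arcin_def by metis
qed

lemma arcin_connected:
  assumes "arcin X b g" "0 \<le> s" "t \<le> b"
  shows "connectedin X (g ` {s..t})"
proof (rule connectedin_continuous_map_image)
  show "continuous_map (top_of_set {0..b}) X g" using assms by (simp add: arcin_def)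
  show "connectedin (top_of_set {0..b}) {s..t}"
    using assms by (auto simp: connectedin_subtopology)
qed

lemma arcin_compact: "arcin X b g \<Longrightarrow> compactin X (g ` {0..b})"
  unfolding arcin_def
  by (rule image_compactin[of "top_of_set {0..b}"]) (auto simp: compactin_subtopology)

text \<open>Provides the first and the last parameter at which an arc meets a closed set.\<close>

lemma arcin_preimage_compact:
  assumes "arcin X b g" "closedin X K"
  shows "compact {t \<in> {0..b}. g t \<in> K}"
proof -
  have "closedin (top_of_set {0..b}) {t \<in> topspace (top_of_set {0..b}). g t \<in> K}"
    using assms by (intro closedin_continuous_map_preimage) (auto simp: arcin_def)
  then have "closed {t \<in> {0..b}. g t \<in> K}"
    by (auto intro: closedin_closed_trans)
  moreover have "bounded {t \<in> {0..b}. g t \<in> K}"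
    by (rule bounded_subset[of "{0..b}"]) auto
  ultimately show ?thesis by (simp add: compact_eq_bounded_closed)
qed

lemma arcin_join:
  assumes g: "arcin X b g" and h: "arcin X c h" and eq: "h 0 = g b"
    and disj: "g ` {0..b} \<inter> h ` {0..c} \<subseteq> {g b}"
  shows "arcin X (b + c) (\<lambda>u. if u \<le> b then g u else h (u - b))"
  unfolding arcin_def
proof (intro conjI)
  show "0 \<le> b + c" using g h by (simp add: arcin_def)
  show "continuous_map (top_of_set {0..b+c}) X (\<lambda>u. if u \<le> b then g u else h (u - b))"
  proof (rule continuous_map_cases_le)
    show "continuous_map (subtopology (top_of_set {0..b+c}) {x \<in> topspace (top_of_set {0..b+c}). x \<le> b}) X g"
      unfolding subtopology_subtopology
      by (rule continuous_map_from_subtopology_mono[of _ "{0..b}"]) (use g in \<open>auto simp: arcin_def\<close>)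
    have "continuous_map (top_of_set {b..b+c}) X (h \<circ> (\<lambda>u. u - b))"
    proof (rule continuous_map_compose)
      show "continuous_map (top_of_set {b..b + c}) (top_of_set {0..c}) (\<lambda>u. u - b)"
        by (auto intro!: continuous_intros)
    qed (use h in \<open>auto simp: arcin_def\<close>)
    then have "continuous_map (top_of_set {b..b+c}) X (\<lambda>u. h (u - b))" by (simp add: o_def)
    then show "continuous_map (subtopology (top_of_set {0..b+c}) {x \<in> topspace (top_of_set {0..b+c}). b \<le> x}) X
        (\<lambda>u. h (u - b))"
      unfolding subtopology_subtopology
      by (rule continuous_map_from_subtopology_mono) auto
  qed (use eq in auto)
  \<comment> \<open>A coincidence between the two pieces can only be the joint \<open>h 0\<close>,
    and injectivity of \<open>h\<close> excludes this for parameters beyond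
    \<open>b\<close>.\<close>
  have cross: False if "u \<in> {0..b}" "v \<in> {b<..b+c}" "g u = h (v - b)" for u v
  proof -
    have c: "v - b \<in> {0..c}" "0 \<in> {0..c}"
      using that by auto
    then have "h (v - b) \<in> g ` {0..b} \<inter> h ` {0..c}" using that by (metis IntI imageI)
    then have "h (v - b) = h 0" using disj eq by auto
    then have "v - b = 0" using h c unfolding arcin_def inj_on_def by blast
    then show False using that by simp
  qed
  show "inj_on (\<lambda>u. if u \<le> b then g u else h (u - b)) {0..b+c}"
  proof (rule inj_onI)
    fix u v assume uv: "u \<in> {0..b+c}" "v \<in> {0..b+c}"
      "(if u \<le> b then g u else h (u - b)) = (if v \<le> b then g v else h (v - b))"
    consider "u \<le> b" "v \<le> b" | "u \<le> b" "v > b" | "u > b" "v \<le> b" | "u > b" "v > b" by linarith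
    then show "u = v"
    proof cases
      case 1
      then have "g u = g v" "u \<in> {0..b}" "v \<in> {0..b}" using uv by auto
      then show ?thesis using g unfolding arcin_def by (meson inj_onD)
    next
      case 2 then show ?thesis using uv cross[of u v] by auto
    next
      case 3 then show ?thesis using uv cross[of v u] by auto
    next
      case 4
      then have "u - b = v - b"
        using uv h by (intro inj_onD[of h "{0..c}"]) (auto simp: arcin_def)
      then show ?thesis by simp
    qed
  qed
qed

text \<open>The map is a parametrisation by the whole line, opposite in direction to the charts of a
  foliation, so intervals of parameters yield arcs and neighbourhoods directly as images.\<close>

definition real_chart :: "'a topology \<Rightarrow> 'a set \<Rightarrow> (real \<Rightarrow> 'a) \<Rightarrow> bool" where
  "real_chart X J e \<longleftrightarrow> openin X J \<and> homeomorphic_map euclideanreal (subtopology X J) e"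

lemma real_chart_facts:
  assumes "real_chart X J e"
  shows real_chart_continuous: "continuous_map euclideanreal X e"
    and real_chart_inj: "inj e"
    and real_chart_range: "range e = J"
    and real_chart_open: "open A \<Longrightarrow> openin X (e ` A)"
    and real_chart_compact: "compact A \<Longrightarrow> compactin X (e ` A)"
proof -
  have J: "openin X J" and e: "homeomorphic_map euclideanreal (subtopology X J) e"
    using assms by (auto simp: real_chart_def)
  then show cont: "continuous_map euclideanreal X e"
    using homeomorphic_imp_continuous_map continuous_map_in_subtopology by blast
  show "inj e" using homeomorphic_imp_injective_map[OF e] by simp
  have "J \<subseteq> topspace X" using J by (rule openin_subset)
  then show "range e = J" using homeomorphic_imp_surjective_map[OF e] by auto
  show "openin X (e ` A)" if "open A"
  proof -
    have "openin (subtopology X J) (e ` A)"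
      using homeomorphic_imp_open_map[OF e] that unfolding open_map_def by auto
    then show ?thesis using J openin_open_subtopology by blast
  qed
  show "compactin X (e ` A)" if "compact A"
    using image_compactin[OF _ cont] that by auto
qed

lemma real_chart_arc:
  assumes "real_chart X J e"
  obtains b g where "arcin X b g" "g 0 = e s" "g b = e t" "g ` {0..b} = e ` closed_segment s t"
proof -
  \<comment> \<open>The sign gives the direction from \<open>s\<close> to \<open>t\<close> at unit
    speed; for \<open>s = t\<close> this is the constant arc of length \<open>0\<close>.\<close>
  define g where "g u = e (s + sgn (t - s) * u)" for u
  have img: "(\<lambda>u. s + sgn (t - s) * u) ` {0..\<bar>t - s\<bar>} = closed_segment s t"
  proof (cases "s \<le> t")
    case True
    then have "(\<lambda>u. s + sgn (t - s) * u) ` {0..\<bar>t - s\<bar>} = (\<lambda>u. s + u) ` {0..t - s}"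
      by (cases "s = t") auto
    then show ?thesis using True by (simp add: closed_segment_eq_real_ivl)
  next
    case False
    then have "(\<lambda>u. s + sgn (t - s) * u) ` {0..\<bar>t - s\<bar>} = (\<lambda>u. s - u) ` {0..s - t}"
      by auto
    then show ?thesis using False by (simp add: closed_segment_eq_real_ivl)
  qed
  have "continuous_map (top_of_set {0..\<bar>t - s\<bar>}) X (e \<circ> (\<lambda>u. s + sgn (t - s) * u))"
    by (rule continuous_map_compose[OF _ real_chart_continuous[OF assms]]) (auto intro!: continuous_intros)
  then have "continuous_map (top_of_set {0..\<bar>t - s\<bar>}) X g" by (simp add: g_def[abs_def] o_def)
  moreover have "inj_on g {0..\<bar>t - s\<bar>}"
    by (auto simp: inj_on_def g_def sgn_if inj_eq[OF real_chart_inj[OF assms]] split: if_splits)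
  ultimately have "arcin X \<bar>t - s\<bar> g" by (simp add: arcin_def)
  moreover have "g 0 = e s" "g \<bar>t - s\<bar> = e t" by (auto simp: g_def sgn_if)
  moreover have "g ` {0..\<bar>t - s\<bar>} = e ` closed_segment s t"
    unfolding img[symmetric] by (auto simp: g_def image_image)
  ultimately show ?thesis by (rule that)
qed

section \<open>Triods and arcs in Hausdorff one-manifolds\<close>

locale one_manifold =
  fixes X :: "'a topology"
  assumes Hausdorff: "Hausdorff_space X"
    and chart: "x \<in> topspace X \<Longrightarrow> \<exists>J e. real_chart X J e \<and> x \<in> J"
begin

text \<open>If \<open>C\<close> missed a point \<open>e a\<close> on the left and a point
  \<open>e b\<close> on the right of \<open>e s\<close>, then the open interval between them and the
  complement of the closed one would separate \<open>e s\<close> from \<open>z\<close> in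
  \<open>C\<close>. The complement is open because compact sets are closed in a Hausdorff
  space.\<close>

lemma connectedin_one_sided_nbhd:
  assumes e: "real_chart X J e" and C: "connectedin X C" "e s \<in> C" "z \<in> C" "z \<noteq> e s"
  obtains d where "d > 0" "e ` {s..s+d} \<subseteq> C \<or> e ` {s-d..s} \<subseteq> C"
proof -
  \<comment> \<open>The radius must leave \<open>z\<close> outside the closed interval. Half the
    parameter distance works when \<open>z\<close> is in the chart, and any radius works
    otherwise.\<close>
  have "\<exists>\<epsilon>>0. z \<notin> e ` {s-\<epsilon>..s+\<epsilon>}"
  proof (cases "z \<in> range e")
    case True
    then obtain r where r: "z = e r" by blast
    then have "r \<noteq> s" using C by blast
    moreover have "z \<notin> e ` {s-\<bar>r-s\<bar>/2..s+\<bar>r-s\<bar>/2}"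
      unfolding r using \<open>r \<noteq> s\<close> inj_image_mem_iff[OF real_chart_inj[OF e]] by (auto simp: field_simps abs_if split: if_splits)
    ultimately show ?thesis by (intro exI[of _ "\<bar>r-s\<bar>/2"]) simp
  next
    case False
    then show ?thesis by (intro exI[of _ 1]) auto
  qed
  then obtain \<epsilon> where \<epsilon>: "\<epsilon> > 0" "z \<notin> e ` {s-\<epsilon>..s+\<epsilon>}" by blast
  have "e ` {s..s+\<epsilon>} \<subseteq> C \<or> e ` {s-\<epsilon>..s} \<subseteq> C"
  proof (rule ccontr)
    assume "\<not> ?thesis"
    then obtain a b where ab: "a \<in> {s-\<epsilon>..s}" "b \<in> {s..s+\<epsilon>}" "e a \<notin> C" "e b \<notin> C" by blast
    have "closedin X (e ` {a..b})"
      using Hausdorff real_chart_compact[OF e] by (simp add: compactin_imp_closedin)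
    then have o2: "openin X (topspace X - e ` {a..b})" by blast
    have o1: "openin X (e ` {a<..<b})" using real_chart_open[OF e] by simp
    have "{a..b} \<subseteq> {a<..<b} \<union> {a,b}" by auto
    then have cover: "e ` {a..b} \<subseteq> e ` {a<..<b} \<union> {e a, e b}" by blast
    have "C \<subseteq> e ` {a<..<b} \<union> (topspace X - e ` {a..b})"
    proof
      fix c assume c: "c \<in> C"
      then have "c \<noteq> e a" "c \<noteq> e b" "c \<in> topspace X"
        using ab(3,4) connectedin_subset_topspace[OF C(1)] by auto
      then show "c \<in> e ` {a<..<b} \<union> (topspace X - e ` {a..b})" using cover by blast
    qed
    moreover have "e ` {a<..<b} \<inter> (topspace X - e ` {a..b}) \<inter> C = {}"
      using image_mono[OF greaterThanLessThan_subseteq_atLeastAtMost_iff[THEN iffD2], of a b a b e] by blast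
    moreover have "a \<noteq> s" "b \<noteq> s" using ab C by blast+
    then have "s \<in> {a<..<b}" using ab by auto
    then have "e ` {a<..<b} \<inter> C \<noteq> {}" using C by blast
    moreover have "{a..b} \<subseteq> {s-\<epsilon>..s+\<epsilon>}" using ab by auto
    then have "(topspace X - e ` {a..b}) \<inter> C \<noteq> {}"
      using \<epsilon>(2) C(3) connectedin_subset_topspace[OF C(1)] by blast
    ultimately show False using C(1) o1 o2 unfolding connectedin by blast
  qed
  with \<epsilon>(1) show ?thesis by (rule that)
qed

text \<open>Pigeonhole: near \<open>w\<close> the line has two sides, and each of the three
  connected sets contains a short interval on one of them. Two sets share a side and hence a point
  other than \<open>w\<close>.\<close>

lemma no_local_triod:
  assumes conn: "connectedin X P" "connectedin X Q" "connectedin X R"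
    and w: "w \<in> P" "w \<in> Q" "w \<in> R"
    and z: "p \<in> P" "q \<in> Q" "r \<in> R" "p \<noteq> w" "q \<noteq> w" "r \<noteq> w"
    and disj: "P \<inter> Q \<subseteq> {w}" "P \<inter> R \<subseteq> {w}" "Q \<inter> R \<subseteq> {w}"
  shows False
proof -
  have "w \<in> topspace X" using conn(1) w connectedin_subset_topspace by blast
  then obtain J e where e: "real_chart X J e" and "w \<in> J" using chart by blast
  then obtain s where s: "w = e s" using real_chart_range by blast
  have side: "\<exists>d>0. e ` {s..s+d} \<subseteq> C \<or> e ` {s-d..s} \<subseteq> C" if "connectedin X C" "w \<in> C" "c \<in> C" "c \<noteq> w" for C c
    using connectedin_one_sided_nbhd[OF e that(1)] that s by metis
  obtain a where a: "a > 0" "e ` {s..s+a} \<subseteq> P \<or> e ` {s-a..s} \<subseteq> P" using side[of P p] assms by blast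
  obtain b where b: "b > 0" "e ` {s..s+b} \<subseteq> Q \<or> e ` {s-b..s} \<subseteq> Q" using side[of Q q] assms by blast
  obtain c where c: "c > 0" "e ` {s..s+c} \<subseteq> R \<or> e ` {s-c..s} \<subseteq> R" using side[of R r] assms by blast
  \<comment> \<open>With the smallest radius, each of \<open>P\<close>, \<open>Q\<close> and
    \<open>R\<close> contains one of the two points \<open>e (s + d)\<close> and
    \<open>e (s - d)\<close>.\<close>
  define d where "d = min a (min b c)"
  have d: "d > 0" "d \<le> a" "d \<le> b" "d \<le> c" using a b c by (auto simp: d_def)
  have "e (s + d) \<noteq> w" "e (s - d) \<noteq> w"
    using d(1) injD[OF real_chart_inj[OF e]] unfolding s by fastforce+
  moreover have "e (s + d) \<in> P \<or> e (s - d) \<in> P" using a(2) d by (auto simp: image_subset_iff)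
  moreover have "e (s + d) \<in> Q \<or> e (s - d) \<in> Q" using b(2) d by (auto simp: image_subset_iff)
  moreover have "e (s + d) \<in> R \<or> e (s - d) \<in> R" using c(2) d by (auto simp: image_subset_iff)
  ultimately show False using disj by blast
qed

text \<open>Let \<open>g t = h s\<close> be the last point of \<open>g\<close> on \<open>h\<close>.
  The end conditions give \<open>t < b\<close> and \<open>s < c\<close>. If \<open>s\<close> were
  positive, the rest of \<open>g\<close> and the two parts of \<open>h\<close> would form a local
  triod at \<open>h s\<close>. So \<open>s = 0\<close>, and injectivity of \<open>g\<close> gives
  \<open>t = 0\<close>: the last meeting is the start.\<close>

lemma arcs_diverge_at_start:
  assumes g: "arcin X b g" and h: "arcin X c h" and start: "g 0 = h 0"
    and ends: "g b \<notin> h ` {0..c}" "h c \<notin> g ` {0..b}"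
  shows "g ` {0..b} \<inter> h ` {0..c} \<subseteq> {g 0}"
proof -
  have bc: "0 \<le> b" "0 \<le> c" and inj: "inj_on g {0..b}" "inj_on h {0..c}"
    using g h by (auto simp: arcin_def)
  let ?T = "{t \<in> {0..b}. g t \<in> h ` {0..c}}"
  have "closedin X (h ` {0..c})" using arcin_compact[OF h] Hausdorff by (simp add: compactin_imp_closedin)
  then have "compact ?T" using arcin_preimage_compact[OF g] by blast
  moreover have "0 \<in> ?T" using bc start by auto
  ultimately obtain t where t: "t \<in> ?T" and max: "\<And>u. u \<in> ?T \<Longrightarrow> u \<le> t"
    using compact_attains_sup[of ?T] by blast
  then obtain s where s: "s \<in> {0..c}" "g t = h s" by blast
  have "t \<noteq> b" using t ends by blast
  then have "t < b" using t by simp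
  have "s \<noteq> c" using s t ends by force
  then have "s < c" using s by simp
  have "s = 0"
  proof (rule ccontr)
    assume "s \<noteq> 0"
    then have "0 < s" using s by simp
    show False
    proof (rule no_local_triod[of "g ` {t..b}" "h ` {0..s}" "h ` {s..c}" "h s" "g b" "h 0" "h c"])
      show "connectedin X (g ` {t..b})" using arcin_connected[OF g] t by simp
      show "connectedin X (h ` {0..s})" "connectedin X (h ` {s..c})" using arcin_connected[OF h] s by simp_all
      show "h s \<in> g ` {t..b}" using t s by force
      show "g b \<noteq> h s" using ends s by blast
      show "h 0 \<noteq> h s" "h c \<noteq> h s" using inj(2) \<open>0 < s\<close> \<open>s < c\<close> by (auto dest!: inj_onD)
      have "g ` {t..b} \<inter> h ` {0..c} \<subseteq> {h s}"
      proof
        fix z assume "z \<in> g ` {t..b} \<inter> h ` {0..c}"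
        then obtain u v where uv: "u \<in> {t..b}" "v \<in> {0..c}" "g u = h v" "z = h v" by auto
        then have "u \<in> ?T" using t by force
        then have "u = t" using max uv by force
        then show "z \<in> {h s}" using s uv by simp
      qed
      moreover have "h ` {0..s} \<subseteq> h ` {0..c}" "h ` {s..c} \<subseteq> h ` {0..c}" using s by auto
      ultimately show "g ` {t..b} \<inter> h ` {0..s} \<subseteq> {h s}" "g ` {t..b} \<inter> h ` {s..c} \<subseteq> {h s}" by blast+
      show "h ` {0..s} \<inter> h ` {s..c} \<subseteq> {h s}"
      proof
        fix z assume "z \<in> h ` {0..s} \<inter> h ` {s..c}"
        then obtain u v where uv: "u \<in> {0..s}" "v \<in> {s..c}" "h u = h v" "z = h v" by auto
        then have "u = v" using s by (intro inj_onD[OF inj(2)]) auto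
        then have "v = s" using uv by simp
        then show "z \<in> {h s}" using uv by simp
      qed
    qed (use \<open>t < b\<close> \<open>s < c\<close> \<open>0 < s\<close> in auto)
  qed
  then have "g t = g 0" using s start by simp
  then have "t = 0" using t bc by (intro inj_onD[OF inj(1)]) auto
  show ?thesis
  proof
    fix z assume "z \<in> g ` {0..b} \<inter> h ` {0..c}"
    then obtain u where u: "u \<in> ?T" "z = g u" by blast
    then have "u = 0" using max \<open>t = 0\<close> by force
    then show "z \<in> {g 0}" using u by simp
  qed
qed

text \<open>Any two of the arcs diverge at \<open>x\<close>, so their images form a local triod
  there. No end point equals \<open>x\<close>, since \<open>x\<close> lies on the other
  arcs.\<close>

lemma no_triod:
  assumes arcs: "arcin X a f" "arcin X b g" "arcin X c h" and start: "f 0 = x" "g 0 = x" "h 0 = x"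
    and ends: "f a \<notin> g ` {0..b}" "f a \<notin> h ` {0..c}" "g b \<notin> f ` {0..a}" "g b \<notin> h ` {0..c}"
      "h c \<notin> f ` {0..a}" "h c \<notin> g ` {0..b}"
  shows False
proof -
  have abc: "0 \<le> a" "0 \<le> b" "0 \<le> c" using arcs by (auto simp: arcin_def)
  then have x: "x \<in> f ` {0..a}" "x \<in> g ` {0..b}" "x \<in> h ` {0..c}"
    using start by (metis atLeastAtMost_iff imageI order_refl)+
  show False
  proof (rule no_local_triod[of "f ` {0..a}" "g ` {0..b}" "h ` {0..c}" x "f a" "g b" "h c"])
    show "f ` {0..a} \<inter> g ` {0..b} \<subseteq> {x}"
      using arcs_diverge_at_start[OF arcs(1,2)] start ends by simp
    show "f ` {0..a} \<inter> h ` {0..c} \<subseteq> {x}"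
      using arcs_diverge_at_start[OF arcs(1,3)] start ends by simp
    show "g ` {0..b} \<inter> h ` {0..c} \<subseteq> {x}"
      using arcs_diverge_at_start[OF arcs(2,3)] start ends by simp
    show "connectedin X (f ` {0..a})" "connectedin X (g ` {0..b})" "connectedin X (h ` {0..c})"
      using arcs arcin_connected by blast+
    show "f a \<noteq> x" "g b \<noteq> x" "h c \<noteq> x" using x ends by blast+
  qed (use x abc in simp_all)
qed

definition arc_related :: "'a \<Rightarrow> 'a \<Rightarrow> bool" where
  "arc_related x y \<longleftrightarrow> (\<exists>b g. arcin X b g \<and> g 0 = x \<and> g b = y)"

text \<open>The arc from \<open>x\<close> is cut where it first hits the segment from
  \<open>y\<close> to \<open>y'\<close> in the chart, and continued inside the segment to
  \<open>y'\<close>. Cutting at the first hit keeps the concatenation injective.\<close>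

lemma arc_related_chart:
  assumes e: "real_chart X J e" and y: "y \<in> J" "y' \<in> J" and xy: "arc_related x y"
  shows "arc_related x y'"
proof -
  obtain b g where g: "arcin X b g" "g 0 = x" "g b = y" using xy by (auto simp: arc_related_def)
  then have "0 \<le> b" by (simp add: arcin_def)
  obtain r s where rs: "y = e r" "y' = e s" using y real_chart_range[OF e] by blast
  let ?B = "e ` closed_segment r s"
  let ?T = "{t \<in> {0..b}. g t \<in> ?B}"
  have "closedin X ?B" using real_chart_compact[OF e] Hausdorff by (simp add: compactin_imp_closedin)
  then have "compact ?T" using arcin_preimage_compact[OF g(1)] by blast
  moreover have "b \<in> ?T" using \<open>0 \<le> b\<close> g rs by auto
  ultimately obtain t where t: "t \<in> ?T" and min: "\<And>u. u \<in> ?T \<Longrightarrow> t \<le> u"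
    using compact_attains_inf[of ?T] by blast
  then obtain q where q: "q \<in> closed_segment r s" "g t = e q" by blast
  have gt: "arcin X t g" using arcin_restrict[OF g(1)] t by simp
  obtain c h where h: "arcin X c h" "h 0 = e q" "h c = e s" "h ` {0..c} = e ` closed_segment q s"
    using real_chart_arc[OF e] by blast
  have "closed_segment q s \<subseteq> closed_segment r s" using q by (simp add: subset_closed_segment)
  then have "g ` {0..t} \<inter> h ` {0..c} \<subseteq> g ` {0..t} \<inter> ?B" unfolding h(4) by blast
  also have "\<dots> \<subseteq> {g t}"
  proof
    fix z assume "z \<in> g ` {0..t} \<inter> ?B"
    then obtain u where u: "u \<in> {0..t}" "g u \<in> ?B" "z = g u" by blast
    then have "u \<in> ?T" using t by auto
    then have "u = t" using min u by force
    then show "z \<in> {g t}" using u by simp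
  qed
  finally have "arcin X (t + c) (\<lambda>u. if u \<le> t then g u else h (u - t))"
    using arcin_join[OF gt h(1)] h q by simp
  moreover have "0 \<le> t" "0 \<le> c" using gt h by (auto simp: arcin_def)
  \<comment> \<open>For \<open>c = 0\<close> the first branch applies, but then \<open>g t\<close>
    is already \<open>h 0 = h c\<close>.\<close>
  moreover have "(if t + c \<le> t then g (t + c) else h (t + c - t)) = y'"
    using \<open>0 \<le> c\<close> h q rs by (cases "c = 0") auto
  ultimately show ?thesis
    unfolding arc_related_def using g(2) by (intro exI[of _ "t + c"] exI[of _ "\<lambda>u. if u \<le> t then g u else h (u - t)"]) simp
qed

text \<open>Being joined to \<open>x\<close> by an arc is constant on each chart, so the points with
  this property form a clopen set, which contains the connected path component of
  \<open>x\<close>.\<close>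

lemma path_component_arc_related:
  assumes "path_component_of X x y"
  shows "arc_related x y"
proof -
  let ?S = "{y \<in> topspace X. arc_related x y}"
  have x: "x \<in> topspace X" using assms path_component_in_topspace by metis
  have "arcin X 0 (\<lambda>_. x)" using x by (auto simp: arcin_def)
  then have "x \<in> ?S" using x by (auto simp: arc_related_def)
  moreover have "openin X ?S"
  proof (subst openin_subopen, rule ballI)
    fix y assume "y \<in> ?S"
    then have "y \<in> topspace X" and y: "arc_related x y" by auto
    then obtain J e where e: "real_chart X J e" "y \<in> J" using chart by blast
    then have "J \<subseteq> ?S" using arc_related_chart y openin_subset unfolding real_chart_def by blast
    then show "\<exists>T. openin X T \<and> y \<in> T \<and> T \<subseteq> ?S" using e unfolding real_chart_def by blast
  qed
  moreover have "openin X (topspace X - ?S)"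
  proof (subst openin_subopen, rule ballI)
    fix y assume "y \<in> topspace X - ?S"
    then have "y \<in> topspace X" and y: "\<not> arc_related x y" by auto
    then obtain J e where e: "real_chart X J e" "y \<in> J" using chart by blast
    then have "J \<subseteq> topspace X - ?S" using arc_related_chart y openin_subset unfolding real_chart_def by blast
    then show "\<exists>T. openin X T \<and> y \<in> T \<and> T \<subseteq> topspace X - ?S" using e unfolding real_chart_def by blast
  qed
  moreover have "connectedin X (Collect (path_component_of X x))"
    by (simp add: path_connectedin_imp_connectedin path_connectedin_path_component_of)
  moreover have "x \<in> Collect (path_component_of X x)" using x by (simp add: path_component_of_refl)
  moreover have "Collect (path_component_of X x) \<subseteq> topspace X" by (simp add: path_component_of_subset_topspace)
  ultimately have "Collect (path_component_of X x) \<subseteq> ?S"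
    unfolding connectedin by blast
  then show ?thesis using assms by blast
qed

lemma countable_path_component_Int:
  assumes T: "closedin X T" and discrete: "\<And>z. z \<in> T \<Longrightarrow> \<exists>P. openin X P \<and> P \<inter> T = {z}"
  shows "countable (Collect (path_component_of X x) \<inter> T)"
proof (rule ccontr)
  let ?Z = "Collect (path_component_of X x) \<inter> T"
  assume "uncountable ?Z"
  \<comment> \<open>The sets \<open>P z\<close> cover the compact set \<open>K \<inter> T\<close>,
    and each contains a single point of \<open>T\<close>, so a finite subcover leaves finitely many
    points.\<close>
  have finite: "finite (K \<inter> T)" if "compactin X K" for K
  proof -
    obtain P where P: "\<And>z. z \<in> T \<Longrightarrow> openin X (P z) \<and> P z \<inter> T = {z}" using discrete by metis
    have "compactin X (K \<inter> T)" using compact_Int_closedin that T by blast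
    moreover have "\<And>U. U \<in> P ` (K \<inter> T) \<Longrightarrow> openin X U" using P by blast
    moreover have "K \<inter> T \<subseteq> \<Union> (P ` (K \<inter> T))" using P by blast
    ultimately obtain \<F> where "finite \<F>" "\<F> \<subseteq> P ` (K \<inter> T)" "K \<inter> T \<subseteq> \<Union> \<F>"
      unfolding compactin_def by metis
    then obtain D where D: "finite D" "D \<subseteq> K \<inter> T" "K \<inter> T \<subseteq> \<Union> (P ` D)" by (metis finite_subset_image)
    have "K \<inter> T \<subseteq> D"
    proof
      fix z assume z: "z \<in> K \<inter> T"
      then obtain d where "d \<in> D" "z \<in> P d" using D(3) by blast
      then have "z \<in> P d \<inter> T" "d \<in> T" using z D(2) by blast+
      then show "z \<in> D" using P[of d] \<open>d \<in> D\<close> by simp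
    qed
    then show ?thesis using D finite_subset by blast
  qed
  have "\<forall>z. \<exists>b g. z \<in> ?Z \<longrightarrow> arcin X b g \<and> g 0 = x \<and> g b = z"
    using path_component_arc_related unfolding arc_related_def by blast
  then obtain b g where g: "\<And>z. z \<in> ?Z \<Longrightarrow> arcin X (b z) (g z) \<and> g z 0 = x \<and> g z (b z) = z"
    by metis
  define A where "A z = g z ` {0..b z}" for z
  have "finite (A z \<inter> ?Z)" if "z \<in> ?Z" for z
    using finite[OF arcin_compact, of "b z" "g z"] g[OF that]
    unfolding A_def by (meson Int_mono finite_subset inf_le2 order_refl)
  \<comment> \<open>The carriers of the chosen arcs form a set mapping with finite values on
    \<open>?Z\<close>; freeness of the triple is the end condition on a triod.\<close>
  then obtain p q r where pqr: "p \<in> ?Z" "q \<in> ?Z" "r \<in> ?Z"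
    "p \<notin> A q" "p \<notin> A r" "q \<notin> A p" "q \<notin> A r" "r \<notin> A p" "r \<notin> A q"
    using uncountable_finite_set_mapping_free_triple[OF \<open>uncountable ?Z\<close>, of A] by blast
  show False
    using no_triod[of "b p" "g p" "b q" "g q" "b r" "g r" x] g[OF pqr(1)] g[OF pqr(2)] g[OF pqr(3)] pqr
    unfolding A_def by simp
qed

end

section \<open>The leaf topology\<close>

lemma embedding_map_subtopology:
  assumes "embedding_map X Y f"
  shows "embedding_map (subtopology X S) Y f"
proof -
  have f: "homeomorphic_map X (subtopology Y (f ` topspace X)) f"
    using assms by (simp add: embedding_map_def)
  have "homeomorphic_map (subtopology X S)
      (subtopology (subtopology Y (f ` topspace X)) (f ` (topspace X \<inter> S))) f"
    using f by (rule homeomorphic_map_subtopologies)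
      (simp only: homeomorphic_imp_surjective_map[OF f, symmetric], blast)
  moreover have "f ` topspace X \<inter> f ` (topspace X \<inter> S) = f ` (topspace X \<inter> S)" by blast
  ultimately show ?thesis
    by (simp add: embedding_map_def subtopology_subtopology)
qed

lemma split_chart_inj:
  assumes "split_chart n p M (U, \<phi>)"
  shows "inj_on \<phi> U"
proof -
  have "openin M U" "homeomorphic_map (subtopology M U) (subtopology (split_Euclidean_space n p) (\<phi> ` U)) \<phi>"
    using assms by (auto simp: split_chart_def)
  then show ?thesis
    using homeomorphic_imp_injective_map openin_subset topspace_subtopology_subset by metis
qed

lemma split_chart_restrict:
  assumes c: "split_chart n p M (U, \<phi>)" and W: "openin M W"
  shows "split_chart n p M (U \<inter> W, restrict \<phi> (U \<inter> W))"
proof -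
  let ?E = "split_Euclidean_space n p"
  have U: "openin M U" "openin ?E (\<phi> ` U)"
    and hom: "homeomorphic_map (subtopology M U) (subtopology ?E (\<phi> ` U)) \<phi>"
    using c by (auto simp: split_chart_def)
  have top: "topspace (subtopology M U) = U" "topspace (subtopology ?E (\<phi> ` U)) = \<phi> ` U"
    using openin_subset[OF U(1)] openin_subset[OF U(2)] by (metis topspace_subtopology_subset)+
  have "openin (subtopology M U) (U \<inter> W)"
    using U W openin_subtopology_Int2 by blast
  then have "openin (subtopology ?E (\<phi> ` U)) (\<phi> ` (U \<inter> W))"
    using homeomorphic_imp_open_map[OF hom] unfolding open_map_def by blast
  then have op: "openin ?E (\<phi> ` (U \<inter> W))"
    using U openin_trans_full by blast
  have "homeomorphic_map (subtopology (subtopology M U) (U \<inter> W))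
      (subtopology (subtopology ?E (\<phi> ` U)) (\<phi> ` (U \<inter> W))) \<phi>"
    using hom by (rule homeomorphic_map_subtopologies) (unfold top, blast)
  moreover have "U \<inter> (U \<inter> W) = U \<inter> W" "\<phi> ` U \<inter> \<phi> ` (U \<inter> W) = \<phi> ` (U \<inter> W)" by auto
  ultimately have "homeomorphic_map (subtopology M (U \<inter> W)) (subtopology ?E (\<phi> ` (U \<inter> W))) \<phi>"
    by (simp only: subtopology_subtopology)
  then have "homeomorphic_map (subtopology M (U \<inter> W)) (subtopology ?E (\<phi> ` (U \<inter> W))) (restrict \<phi> (U \<inter> W))"
    by (rule homeomorphic_map_eq) auto
  then show ?thesis
    using op U W by (auto simp: split_chart_def)
qed

lemma foliated_change_restrict:
  assumes inj: "inj_on \<phi> U" and change: "foliated_change n p (U, \<phi>) (V, \<psi>)"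
  shows "foliated_change n p (U \<inter> W, restrict \<phi> (U \<inter> W)) (V \<inter> W', restrict \<psi> (V \<inter> W'))"
proof -
  let ?S = "U \<inter> W \<inter> (V \<inter> W')"
  obtain g h where
    g: "continuous_map (subtopology (split_Euclidean_space n p) (\<phi> ` (U \<inter> V))) (Euclidean_space p) g" and
    h: "embedding_map (subtopology (Euclidean_space (n - p)) (snd ` \<phi> ` (U \<inter> V))) (Euclidean_space (n - p)) h" and
    gh: "\<And>x y. (x, y) \<in> \<phi> ` (U \<inter> V) \<Longrightarrow> \<psi> (inv_into U \<phi> (x, y)) = (g (x, y), h y)"
    using change unfolding foliated_change_def by blast
  have S: "restrict \<phi> (U \<inter> W) ` ?S = \<phi> ` ?S" by (rule image_cong) auto
  have "continuous_map (subtopology (split_Euclidean_space n p) (\<phi> ` ?S)) (Euclidean_space p) g"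
    using g by (rule continuous_map_from_subtopology_mono) auto
  moreover have "snd ` \<phi> ` (U \<inter> V) \<inter> snd ` \<phi> ` ?S = snd ` \<phi> ` ?S" by blast
  then have "embedding_map (subtopology (Euclidean_space (n - p)) (snd ` \<phi> ` ?S)) (Euclidean_space (n - p)) h"
    using embedding_map_subtopology[OF h, of "snd ` \<phi> ` ?S"] by (simp only: subtopology_subtopology)
  moreover have "restrict \<psi> (V \<inter> W') (inv_into (U \<inter> W) (restrict \<phi> (U \<inter> W)) (x, y)) = (g (x, y), h y)"
    if xy: "(x, y) \<in> \<phi> ` ?S" for x y
  proof -
    obtain z where z: "z \<in> ?S" "\<phi> z = (x, y)" using xy by auto
    have "inj_on (restrict \<phi> (U \<inter> W)) (U \<inter> W)"
      using inj by (auto simp: inj_on_def)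
    then have "inv_into (U \<inter> W) (restrict \<phi> (U \<inter> W)) (x, y) = z"
      using z by (intro inv_into_f_eq) auto
    moreover have "inv_into U \<phi> (x, y) = z"
      using z inj by (intro inv_into_f_eq) auto
    moreover have "(x, y) \<in> \<phi> ` (U \<inter> V)" using xy by auto
    ultimately show ?thesis using gh[of x y] z by auto
  qed
  ultimately show ?thesis
    unfolding foliated_change_def prod.case S by blast
qed

text \<open>Adjoining all restrictions to open sets again yields a foliated atlas, so maximality
  puts them into \<open>F\<close>.\<close>

lemma foliation_restrict:
  assumes F: "foliation n p M F" and c: "(U, \<phi>) \<in> F" and W: "openin M W"
  shows "(U \<inter> W, restrict \<phi> (U \<inter> W)) \<in> F"
proof -
  define A where "A = {(U \<inter> W, restrict \<phi> (U \<inter> W)) | U \<phi> W. (U, \<phi>) \<in> F \<and> openin M W}"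
  have charts: "\<And>c. c \<in> F \<Longrightarrow> split_chart n p M c" and cover: "(\<Union>(U, \<phi>) \<in> F. U) = topspace M"
    and change: "\<And>c d. c \<in> F \<Longrightarrow> d \<in> F \<Longrightarrow> foliated_change n p c d"
    using F unfolding foliation_def foliated_atlas_def by blast+
  \<comment> \<open>A chart is its own restriction to the whole space; equality of the maps relies
    on their being \<open>undefined\<close> off the domain.\<close>
  have "F \<subseteq> A"
  proof (clarify)
    fix U \<phi> assume c: "(U, \<phi>) \<in> F"
    then have "openin M U" "\<phi> \<in> extensional U" using charts[OF c] by (auto simp: split_chart_def)
    then have "U \<inter> topspace M = U" "restrict \<phi> U = \<phi>" by (auto simp: extensional_restrict dest: openin_subset)
    then have "(U, \<phi>) = (U \<inter> topspace M, restrict \<phi> (U \<inter> topspace M))" by simp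
    then show "(U, \<phi>) \<in> A" using c unfolding A_def by blast
  qed
  moreover have "foliated_atlas n p M A"
    unfolding foliated_atlas_def
  proof (intro conjI ballI)
    show "split_chart n p M c" if "c \<in> A" for c
      using that charts split_chart_restrict unfolding A_def by blast
    then have "(\<Union>(U, \<phi>) \<in> A. U) \<subseteq> topspace M"
      by (fastforce simp: split_chart_def dest: openin_subset)
    moreover have "topspace M \<subseteq> (\<Union>(U, \<phi>) \<in> A. U)"
      unfolding cover[symmetric] using \<open>F \<subseteq> A\<close> by (rule UN_mono) simp
    ultimately show "(\<Union>(U, \<phi>) \<in> A. U) = topspace M" by (rule subset_antisym)
    show "foliated_change n p c d" if "c \<in> A" "d \<in> A" for c d
    proof -
      obtain U \<phi> W where c: "c = (U \<inter> W, restrict \<phi> (U \<inter> W))" "(U, \<phi>) \<in> F" using \<open>c \<in> A\<close> unfolding A_def by blast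
      obtain V \<psi> W' where d: "d = (V \<inter> W', restrict \<psi> (V \<inter> W'))" "(V, \<psi>) \<in> F" using \<open>d \<in> A\<close> unfolding A_def by blast
      show ?thesis
        unfolding c(1) d(1)
        by (rule foliated_change_restrict[OF split_chart_inj[OF charts[OF c(2)]] change[OF c(2) d(2)]])
    qed
  qed
  ultimately have "A = F" using F unfolding foliation_def by blast
  then show ?thesis using c W unfolding A_def by blast
qed

text \<open>The transverse part \<open>h\<close> of a coordinate change depends on \<open>y\<close>
  alone. This is why plaques of different charts agree locally.\<close>

lemma foliated_change_snd:
  assumes "foliated_change n p (U, \<phi>) (V, \<psi>)" "inj_on \<phi> U"
    and "z \<in> U \<inter> V" "z' \<in> U \<inter> V" "snd (\<phi> z) = snd (\<phi> z')"
  shows "snd (\<psi> z) = snd (\<psi> z')"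
proof -
  obtain g h where gh: "\<forall>(x, y) \<in> \<phi> ` (U \<inter> V). \<psi> (inv_into U \<phi> (x, y)) = (g (x, y), h y)"
    using assms(1) unfolding foliated_change_def by blast
  have "snd (\<psi> w) = h (snd (\<phi> w))" if "w \<in> U \<inter> V" for w
  proof -
    have "inv_into U \<phi> (\<phi> w) = w" using assms(2) that by simp
    then show ?thesis using bspec[OF gh imageI[OF that]] by (cases "\<phi> w") auto
  qed
  then show ?thesis using assms by metis
qed

text \<open>Transports a curve \<open>l\<close> of the model space to the manifold through the
  inverse chart \<rho>, on the open set of parameters where \<open>l\<close> runs in the chart
  image. Lines along the leaf direction give plaques, lines across it give transversals.\<close>

lemma split_chart_pullback:
  assumes c: "split_chart n p M (U, \<phi>)" and l: "continuous_map euclideanreal (split_Euclidean_space n p) l"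
  defines "D \<equiv> {s. l s \<in> \<phi> ` U}"
  obtains \<rho> where "open D" "continuous_map (top_of_set D) M (\<lambda>s. \<rho> (l s))"
    "\<And>z. z \<in> U \<Longrightarrow> \<rho> (\<phi> z) = z" "\<And>s. s \<in> D \<Longrightarrow> \<rho> (l s) \<in> U \<and> \<phi> (\<rho> (l s)) = l s"
proof -
  let ?E = "split_Euclidean_space n p"
  have U: "openin M U" "openin ?E (\<phi> ` U)"
    and hom: "homeomorphic_map (subtopology M U) (subtopology ?E (\<phi> ` U)) \<phi>"
    using c by (auto simp: split_chart_def)
  have top: "topspace (subtopology M U) = U" "topspace (subtopology ?E (\<phi> ` U)) = \<phi> ` U"
    using openin_subset[OF U(1)] openin_subset[OF U(2)] by (metis topspace_subtopology_subset)+
  obtain \<rho> where \<rho>: "homeomorphic_maps (subtopology M U) (subtopology ?E (\<phi> ` U)) \<phi> \<rho>"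
    using hom homeomorphic_map_maps by blast
  have inv: "\<rho> (\<phi> z) = z" if "z \<in> U" for z
    using \<rho> that unfolding homeomorphic_maps_def top by blast
  have "openin euclideanreal {s \<in> topspace euclideanreal. l s \<in> \<phi> ` U}"
    using l U(2) by (rule openin_continuous_map_preimage)
  then have "open D" by (simp add: D_def)
  moreover have "continuous_map (top_of_set D) (subtopology ?E (\<phi> ` U)) l"
    using l by (auto simp: continuous_map_in_subtopology D_def continuous_map_from_subtopology)
  moreover have "continuous_map (subtopology ?E (\<phi> ` U)) M \<rho>"
    using \<rho> unfolding homeomorphic_maps_def continuous_map_in_subtopology by blast
  ultimately have "continuous_map (top_of_set D) M (\<rho> \<circ> l)"
    using continuous_map_compose by blast
  then have "continuous_map (top_of_set D) M (\<lambda>s. \<rho> (l s))" by (simp add: o_def)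
  moreover have "\<rho> (l s) \<in> U \<and> \<phi> (\<rho> (l s)) = l s" if "s \<in> D" for s
    using that inv unfolding D_def by auto
  ultimately show ?thesis using that \<open>open D\<close> inv by blast
qed

section \<open>Plaques as charts of the leaf topology\<close>

lemma foliation_charts:
  assumes "foliation n p M F" "c \<in> F"
  shows "split_chart n p M c"
  using assms unfolding foliation_def foliated_atlas_def by blast

lemma foliation_cover:
  assumes "foliation n p M F" "z \<in> topspace M"
  obtains U \<phi> where "(U, \<phi>) \<in> F" "z \<in> U"
proof -
  have "z \<in> (\<Union>(U, \<phi>) \<in> F. U)" using assms unfolding foliation_def foliated_atlas_def by blast
  then show ?thesis using that by blast
qed

lemma split_chart_continuous:
  assumes "split_chart n p M (U, \<phi>)"
  shows "continuous_map (subtopology M U) (split_Euclidean_space n p) \<phi>"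
  using assms homeomorphic_imp_continuous_map continuous_map_into_fulltopology
  unfolding split_chart_def by blast

lemma split_chart_in_topspace:
  assumes "split_chart n p M (U, \<phi>)" "z \<in> U"
  shows "fst (\<phi> z) \<in> topspace (Euclidean_space p)" "snd (\<phi> z) \<in> topspace (Euclidean_space (n - p))"
proof -
  have "\<phi> ` U \<subseteq> topspace (split_Euclidean_space n p)"
    using assms openin_subset unfolding split_chart_def by blast
  then have "\<phi> z \<in> topspace (Euclidean_space p) \<times> topspace (Euclidean_space (n - p))"
    using assms(2) unfolding topspace_prod_topology by blast
  then show "fst (\<phi> z) \<in> topspace (Euclidean_space p)" "snd (\<phi> z) \<in> topspace (Euclidean_space (n - p))"
    by (auto simp: mem_Times_iff)
qed

lemma continuous_map_Euclidean_space_component: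
  "continuous_map (Euclidean_space n) euclideanreal (\<lambda>x. x i)"
  unfolding Euclidean_space_def
  by (rule continuous_map_from_subtopology) (rule continuous_map_product_projection, simp)

text \<open>The line through \<open>\<phi> z\<close> in the leaf direction stays in the chart image
  for parameters in a small ball. Its pullback \<open>J\<close> is an interval, and it is an entire
  plaque of a suitably restricted chart.\<close>

lemma plaque_nbhd:
  assumes F: "foliation n 1 M F" and c: "(U, \<phi>) \<in> F" and z: "z \<in> U"
  obtains J e where "z \<in> J" "J \<subseteq> {w \<in> U. snd (\<phi> w) = snd (\<phi> z)}" "J \<in> plaques M F"
    "homeomorphic_map euclideanreal (subtopology M J) e"
proof -
  note sc = foliation_charts[OF F c]
  have U: "openin M U" using sc by (simp add: split_chart_def)
  define y where "y = snd (\<phi> z)"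
  define coord where "coord w = fst (\<phi> w) 0" for w
  \<comment> \<open>A point of \<open>Euclidean_space 1\<close> is a sequence that vanishes beyond
    index \<open>0\<close>, so \<open>s\<close> is its only free entry.\<close>
  define l :: "real \<Rightarrow> (nat \<Rightarrow> real) \<times> (nat \<Rightarrow> real)" where "l s = ((\<lambda>i. if i < 1 then s else 0), y)" for s
  have l_coord: "l (coord w) = \<phi> w" if "w \<in> U" "snd (\<phi> w) = y" for w
    using split_chart_in_topspace(1)[OF sc that(1)] that(2)
    by (auto simp: l_def coord_def topspace_Euclidean_space prod_eq_iff fun_eq_iff)
  have "continuous_map euclideanreal (Euclidean_space 1) (\<lambda>s i. if i < 1 then s else 0)"
    by (subst continuous_map_componentwise_Euclidean_space) simp
  moreover have "y \<in> topspace (Euclidean_space (n - 1))"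
    using split_chart_in_topspace(2)[OF sc z] by (simp add: y_def)
  ultimately have "continuous_map euclideanreal (split_Euclidean_space n 1) l"
    unfolding l_def by (intro continuous_map_pairedI) auto
  from split_chart_pullback[OF sc this]
  obtain \<rho> where D: "open {s. l s \<in> \<phi> ` U}"
    and cont: "continuous_map (top_of_set {s. l s \<in> \<phi> ` U}) M (\<lambda>s. \<rho> (l s))"
    and \<rho>\<phi>: "\<And>w. w \<in> U \<Longrightarrow> \<rho> (\<phi> w) = w"
    and \<phi>\<rho>: "\<And>s. l s \<in> \<phi> ` U \<Longrightarrow> \<rho> (l s) \<in> U \<and> \<phi> (\<rho> (l s)) = l s"
    by (metis mem_Collect_eq)
  have "coord z \<in> {s. l s \<in> \<phi> ` U}" using l_coord[OF z] z by (simp add: y_def)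
  then obtain \<epsilon> where \<epsilon>: "\<epsilon> > 0" "ball (coord z) \<epsilon> \<subseteq> {s. l s \<in> \<phi> ` U}"
    using D by (meson open_contains_ball)
  define B where "B = ball (coord z) \<epsilon>"
  define J where "J = {w \<in> U. snd (\<phi> w) = y \<and> coord w \<in> B}"
  have "continuous_map (split_Euclidean_space n 1) euclideanreal (\<lambda>v. fst v 0)"
    using continuous_map_compose[OF continuous_map_fst continuous_map_Euclidean_space_component]
    by (simp add: o_def)
  from continuous_map_compose[OF split_chart_continuous[OF sc] this]
  have coord: "continuous_map (subtopology M U) euclideanreal coord"
    by (simp add: o_def coord_def[abs_def])
  have "homeomorphic_maps (top_of_set B) (subtopology M J) (\<lambda>s. \<rho> (l s)) coord"
    unfolding homeomorphic_maps_def
  proof (intro conjI ballI)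
    have "\<rho> (l s) \<in> J" if "s \<in> B" for s
    proof -
      have "l s \<in> \<phi> ` U" using that \<epsilon>(2) unfolding B_def by blast
      then show ?thesis using \<phi>\<rho>[of s] that by (simp add: J_def coord_def l_def)
    qed
    moreover have "continuous_map (top_of_set B) M (\<lambda>s. \<rho> (l s))"
      using cont \<epsilon>(2) unfolding B_def by (rule continuous_map_from_subtopology_mono)
    ultimately show "continuous_map (top_of_set B) (subtopology M J) (\<lambda>s. \<rho> (l s))"
      by (auto simp: continuous_map_in_subtopology)
    have "continuous_map (subtopology M J) euclideanreal coord"
      using coord by (rule continuous_map_from_subtopology_mono) (auto simp: J_def)
    then show "continuous_map (subtopology M J) (top_of_set B) coord"
      by (auto simp: continuous_map_in_subtopology J_def)
    show "coord (\<rho> (l s)) = s" if "s \<in> topspace (top_of_set B)" for s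
    proof -
      have "l s \<in> \<phi> ` U" using that \<epsilon>(2) unfolding B_def by auto
      then show ?thesis using \<phi>\<rho>[of s] by (simp add: coord_def l_def)
    qed
    show "\<rho> (l (coord w)) = w" if "w \<in> topspace (subtopology M J)" for w
      using that l_coord \<rho>\<phi> by (auto simp: J_def)
  qed
  then have B_J: "homeomorphic_map (top_of_set B) (subtopology M J) (\<lambda>s. \<rho> (l s))"
    using homeomorphic_map_maps by blast
  \<comment> \<open>Stretching the ball to the whole line gives the parametrisation the required
    domain.\<close>
  have "(UNIV :: real set) homeomorphic B"
    unfolding B_def using \<epsilon>(1) homeomorphic_ball_UNIV homeomorphic_sym by blast
  then obtain k k' where "homeomorphism (UNIV :: real set) B k k'" unfolding homeomorphic_def by blast
  then have "homeomorphic_maps euclideanreal (top_of_set B) k k'"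
    by (auto simp: homeomorphic_maps_def homeomorphism_def continuous_map_in_subtopology)
  then have "homeomorphic_map euclideanreal (top_of_set B) k"
    using homeomorphic_map_maps by blast
  from homeomorphic_map_compose[OF this B_J]
  obtain e where e: "homeomorphic_map euclideanreal (subtopology M J) e" by blast
  have "z \<in> J" using z \<epsilon>(1) by (simp add: J_def y_def B_def)
  have J: "J \<subseteq> {w \<in> U. snd (\<phi> w) = snd (\<phi> z)}" by (auto simp: J_def y_def)
  have "J \<in> plaques M F"
  proof -
    \<comment> \<open>Restricting the chart to leaf coordinates in \<open>B\<close> makes its slice
      at height \<open>y\<close> equal to \<open>J\<close>; as \<open>J\<close> is connected, it is
      the only component of the slice.\<close>
    define W where "W = {w \<in> U. coord w \<in> B}"
    have "openin (subtopology M U) {w \<in> topspace (subtopology M U). coord w \<in> B}"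
      using coord by (rule openin_continuous_map_preimage) (simp add: B_def)
    then have "openin (subtopology M U) W"
      unfolding W_def using topspace_subtopology_subset[OF openin_subset[OF U]] by (simp only:)
    then have "openin M W" using U by (rule openin_trans_full)
    then have chart: "(U \<inter> W, restrict \<phi> (U \<inter> W)) \<in> F" by (rule foliation_restrict[OF F c])
    have eq: "{w \<in> U \<inter> W. snd (restrict \<phi> (U \<inter> W) w) = y} = J" by (auto simp: J_def W_def)
    have "connected_space (subtopology M J)"
      using e homeomorphic_connected_space homeomorphic_map_imp_homeomorphic_space
      connectedin_topspace[of euclideanreal] connected_UNIV by (metis connectedin_iff_connected topspace_euclidean)
    moreover have "topspace (subtopology M J) = J"
      using openin_subset[OF U] J by (intro topspace_subtopology_subset) blast
    moreover from this have "subtopology M J \<noteq> trivial_topology" using \<open>z \<in> J\<close> by (metis empty_iff topspace_discrete_topology)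
    ultimately have "connected_components_of (subtopology M J) = {J}"
      by (simp add: connected_components_of_eq_singleton)
    then have "J \<in> connected_components_of (subtopology M {w \<in> U \<inter> W. snd (restrict \<phi> (U \<inter> W) w) = y})"
      unfolding eq by simp
    then show ?thesis unfolding plaques_def using chart by blast
  qed
  then show ?thesis using that \<open>z \<in> J\<close> J e by blast
qed

lemma topspace_leaf_topology:
  assumes F: "foliation n 1 M F"
  shows "topspace (leaf_topology M F) = topspace M"
proof -
  have "\<Union> (plaques M F) \<subseteq> topspace M"
    unfolding plaques_def using connected_components_of_subset by fastforce
  moreover have "z \<in> \<Union> (plaques M F)" if z: "z \<in> topspace M" for z
  proof -
    obtain U \<phi> where c: "(U, \<phi>) \<in> F" "z \<in> U" using foliation_cover[OF F z] by blast
    show ?thesis using plaque_nbhd[OF F c] by blast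
  qed
  ultimately show ?thesis unfolding leaf_topology_def by auto
qed

text \<open>Restricting a chart to \<open>W\<close> keeps its plaques inside \<open>W\<close>, so
  every point of \<open>W\<close> has a plaque around it that does not leave
  \<open>W\<close>.\<close>

lemma openin_leaf_topology:
  assumes F: "foliation n 1 M F" and W: "openin M W"
  shows "openin (leaf_topology M F) W"
proof (subst openin_subopen, rule ballI)
  fix z assume z: "z \<in> W"
  then obtain U \<phi> where c: "(U, \<phi>) \<in> F" "z \<in> U" using foliation_cover[OF F] W openin_subset by blast
  have "z \<in> U \<inter> W" using c z by blast
  then obtain J where J: "z \<in> J" "J \<subseteq> {w \<in> U \<inter> W. snd (restrict \<phi> (U \<inter> W) w) = snd (restrict \<phi> (U \<inter> W) z)}"
    "J \<in> plaques M F"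
    by (rule plaque_nbhd[OF F foliation_restrict[OF F c(1) W]])
  have "J \<subseteq> W" using J(2) by blast
  with J(1,3) show "\<exists>T. openin (leaf_topology M F) T \<and> z \<in> T \<and> T \<subseteq> W"
    unfolding leaf_topology_def using topology_generated_by_Basis by blast
qed

text \<open>The leaf topology is finer, so only its traces on \<open>J\<close> need an argument.
  Near a point of \<open>J\<close> on a plaque \<open>Q\<close> of another chart, a small interval
  of \<open>J\<close> stays in that chart at constant transverse coordinate. Being connected, it
  lies in the component \<open>Q\<close>.\<close>

lemma leaf_topology_eq_on_plaque_nbhd:
  assumes F: "foliation n 1 M F" and c: "(U, \<phi>) \<in> F" and J: "J \<subseteq> {w \<in> U. snd (\<phi> w) = y}"
    and e: "homeomorphic_map euclideanreal (subtopology M J) e"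
  shows "subtopology (leaf_topology M F) J = subtopology M J"
proof -
  note sc = foliation_charts[OF F c]
  have J_top: "J \<subseteq> topspace M" using sc J openin_subset unfolding split_chart_def by blast
  then have top: "topspace (subtopology M J) = J" by (rule topspace_subtopology_subset)
  have cont: "continuous_map euclideanreal M e"
    using homeomorphic_imp_continuous_map[OF e] continuous_map_into_fulltopology by blast
  have range: "range e = J" using homeomorphic_imp_surjective_map[OF e] top by simp
  have basic: "openin (subtopology M J) (Q \<inter> J)" if Q: "Q \<in> plaques M F" for Q
  proof (subst openin_subopen, rule ballI)
    fix a assume a: "a \<in> Q \<inter> J"
    obtain V \<psi> y' where d: "(V, \<psi>) \<in> F"
      and Q: "Q \<in> connected_components_of (subtopology M {w \<in> V. snd (\<psi> w) = y'})"
      using Q unfolding plaques_def by blast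
    have Q_sub: "Q \<subseteq> {w \<in> V. snd (\<psi> w) = y'}"
      using connected_components_of_subset[OF Q] by auto
    have "openin M V" using foliation_charts[OF F d] by (simp add: split_chart_def)
    then have "openin euclideanreal {t \<in> topspace euclideanreal. e t \<in> V}"
      using cont openin_continuous_map_preimage by blast
    then have "open {t. e t \<in> V}" by simp
    moreover obtain s where s: "a = e s" using a range by blast
    then have "s \<in> {t. e t \<in> V}" using a Q_sub by blast
    ultimately obtain \<delta> where \<delta>: "\<delta> > 0" "ball s \<delta> \<subseteq> {t. e t \<in> V}" by (meson open_contains_ball)
    let ?G = "e ` ball s \<delta>"
    have "open_map euclideanreal (subtopology M J) e" using e by (rule homeomorphic_imp_open_map)
    then have G_open: "openin (subtopology M J) ?G" unfolding open_map_def by simp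
    have G: "?G \<subseteq> J" "?G \<subseteq> V" using range \<delta> by blast+
    have "a \<in> ?G" using s \<delta> by simp
    have "snd (\<psi> w) = y'" if "w \<in> ?G" for w
    proof -
      have "foliated_change n 1 (U, \<phi>) (V, \<psi>)" using F c d unfolding foliation_def foliated_atlas_def by blast
      then have "snd (\<psi> w) = snd (\<psi> a)"
        using split_chart_inj[OF sc] by (rule foliated_change_snd) (use that a G J Q_sub in auto)
      then show ?thesis using a Q_sub by blast
    qed
    then have "?G \<subseteq> {w \<in> V. snd (\<psi> w) = y'}" using G by blast
    moreover have "connectedin M ?G"
      using cont by (rule connectedin_continuous_map_image) simp
    ultimately have "connectedin (subtopology M {w \<in> V. snd (\<psi> w) = y'}) ?G"
      by (simp add: connectedin_subtopology)
    then have "?G \<subseteq> Q"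
      using connected_components_of_maximal[OF Q] a \<open>a \<in> ?G\<close> by (auto simp: disjnt_iff)
    then show "\<exists>T. openin (subtopology M J) T \<and> a \<in> T \<and> T \<subseteq> Q \<inter> J"
      using G_open G \<open>a \<in> ?G\<close> by blast
  qed
  \<comment> \<open>Openness of the trace passes from plaques to finite intersections and unions,
    hence to all leaf-open sets.\<close>
  have "openin (subtopology M J) (\<Omega> \<inter> J)" if "generate_topology_on (plaques M F) \<Omega>" for \<Omega>
    using that
  proof induction
    case (Int a b)
    have "a \<inter> b \<inter> J = (a \<inter> J) \<inter> (b \<inter> J)" by blast
    then show ?case using Int.IH by (metis openin_Int)
  next
    case (UN K)
    have eq: "\<Union> K \<inter> J = (\<Union>k\<in>K. k \<inter> J)" by blast
    show ?case
      unfolding eq by (rule openin_Union) (use UN.IH in blast)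
  next
    case (Basis Q)
    then show ?case by (rule basic)
  qed simp
  then have coarse: "openin (subtopology M J) (\<Omega> \<inter> J)" if "openin (leaf_topology M F) \<Omega>" for \<Omega>
    using that unfolding leaf_topology_def openin_topology_generated_by_iff by blast
  show ?thesis
    unfolding topology_eq
  proof (intro allI iffI)
    fix S assume "openin (subtopology (leaf_topology M F) J) S"
    then show "openin (subtopology M J) S"
      using coarse by (auto simp: openin_subtopology[of "leaf_topology M F"])
  next
    fix S assume "openin (subtopology M J) S"
    then show "openin (subtopology (leaf_topology M F) J) S"
      using openin_leaf_topology[OF F] by (auto simp: openin_subtopology)
  qed
qed

text \<open>The Hausdorff property passes to the finer topology, and plaque intervals serve as
  charts, since both topologies agree on them.\<close>

lemma one_manifold_leaf_topology:
  assumes M: "Hausdorff_space M" and F: "foliation n 1 M F"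
  shows "one_manifold (leaf_topology M F)"
proof
  show "Hausdorff_space (leaf_topology M F)"
    using M openin_leaf_topology[OF F] unfolding Hausdorff_space_def topspace_leaf_topology[OF F] by meson
  fix z assume "z \<in> topspace (leaf_topology M F)"
  then have z: "z \<in> topspace M" using topspace_leaf_topology[OF F] by simp
  obtain U \<phi> where c: "(U, \<phi>) \<in> F" "z \<in> U" using foliation_cover[OF F z] by blast
  obtain J e where J: "z \<in> J" "J \<subseteq> {w \<in> U. snd (\<phi> w) = snd (\<phi> z)}" "J \<in> plaques M F"
    "homeomorphic_map euclideanreal (subtopology M J) e"
    using plaque_nbhd[OF F c] by blast
  have "openin (leaf_topology M F) J"
    unfolding leaf_topology_def using J(3) by (rule topology_generated_by_Basis)
  then have "real_chart (leaf_topology M F) J e"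
    unfolding real_chart_def leaf_topology_eq_on_plaque_nbhd[OF F c(1) J(2) J(4)] using J(4) by blast
  then show "\<exists>J e. real_chart (leaf_topology M F) J e \<and> z \<in> J" using J(1) by blast
qed

section \<open>Counting leaves\<close>

lemma countable_fibres_lepoll:
  assumes T: "uncountable T" and fib: "\<And>b. countable {t \<in> T. f t = b}"
  shows "T \<lesssim> f ` T"
proof -
  have "infinite (f ` T)"
  proof
    assume "finite (f ` T)"
    then have "countable (\<Union>b\<in>f ` T. {t \<in> T. f t = b})" using fib by (intro countable_UN) (auto intro: countable_finite)
    moreover have "T \<subseteq> (\<Union>b\<in>f ` T. {t \<in> T. f t = b})" by blast
    ultimately show False using T countable_subset by blast
  qed
  define c where "c t = (f t, to_nat_on {u \<in> T. f u = f t} t)" for t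
  have "inj_on c T"
  proof (rule inj_onI)
    fix t u assume tu: "t \<in> T" "u \<in> T" "c t = c u"
    then have "f t = f u" by (simp add: c_def)
    then show "t = u"
      using tu inj_on_to_nat_on[OF fib[of "f t"]] by (auto simp: c_def dest!: inj_onD)
  qed
  then have "T \<lesssim> f ` T \<times> (UNIV :: nat set)"
    unfolding lepoll_def by (intro exI[of _ c]) (auto simp: c_def)
  also have "\<dots> \<approx> f ` T"
    unfolding eqpoll_iff_card_of_ordIso
    using \<open>infinite (f ` T)\<close> by (intro card_of_Times_infinite_simps) (auto simp: infinite_iff_card_of_nat)
  finally show ?thesis .
qed

text \<open>The pullback of a short closed segment along which only the first transverse coordinate
  varies; \<open>n \<ge> 2\<close> ensures that there is such a coordinate.\<close>

lemma compact_transversal: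
  assumes F: "foliation n 1 M F" and c: "(U, \<phi>) \<in> F" and z: "z \<in> U" and n: "n \<ge> 2"
  obtains T where "T \<approx> (UNIV :: real set)" "compactin M T" "T \<subseteq> U" "inj_on (\<lambda>w. snd (\<phi> w)) T"
proof -
  note sc = foliation_charts[OF F c]
  define x where "x = fst (\<phi> z)"
  define y where "y = snd (\<phi> z)"
  \<comment> \<open>All coordinates of \<open>\<phi> z\<close> are kept except the transverse one at
    index \<open>0\<close>, so the line passes through \<open>\<phi> z\<close> at
    \<open>s = y 0\<close>.\<close>
  define l :: "real \<Rightarrow> (nat \<Rightarrow> real) \<times> (nat \<Rightarrow> real)"
    where "l s = (x, (\<lambda>i. if i < n - 1 then (if i = 0 then s else y i) else 0))" for s
  have xy: "x \<in> topspace (Euclidean_space 1)" "y \<in> topspace (Euclidean_space (n - 1))"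
    using split_chart_in_topspace[OF sc z] by (auto simp: x_def y_def)
  have "continuous_map euclideanreal (Euclidean_space (n - 1))
      (\<lambda>s i. if i < n - 1 then (if i = 0 then s else y i) else 0)"
    by (subst continuous_map_componentwise_Euclidean_space) simp
  then have "continuous_map euclideanreal (split_Euclidean_space n 1) l"
    unfolding l_def using xy(1) by (intro continuous_map_pairedI) auto
  from split_chart_pullback[OF sc this]
  obtain \<rho> where D: "open {s. l s \<in> \<phi> ` U}"
    and cont: "continuous_map (top_of_set {s. l s \<in> \<phi> ` U}) M (\<lambda>s. \<rho> (l s))"
    and \<phi>\<rho>: "\<And>s. l s \<in> \<phi> ` U \<Longrightarrow> \<rho> (l s) \<in> U \<and> \<phi> (\<rho> (l s)) = l s"
    by (metis mem_Collect_eq)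
  have "l (y 0) = \<phi> z"
    using xy(2) by (auto simp: l_def x_def y_def topspace_Euclidean_space prod_eq_iff fun_eq_iff)
  then have "y 0 \<in> {s. l s \<in> \<phi> ` U}" using z by simp
  \<comment> \<open>A closed ball is taken, so that its image \<open>T\<close> is compact.\<close>
  then obtain \<epsilon> where \<epsilon>: "\<epsilon> > 0" "cball (y 0) \<epsilon> \<subseteq> {s. l s \<in> \<phi> ` U}"
    using D by (meson open_contains_cball)
  define T where "T = (\<lambda>s. \<rho> (l s)) ` cball (y 0) \<epsilon>"
  have \<phi>T: "\<rho> (l s) \<in> U \<and> snd (\<phi> (\<rho> (l s))) 0 = s" if "s \<in> cball (y 0) \<epsilon>" for s
  proof -
    have "l s \<in> \<phi> ` U" using that \<epsilon>(2) by blast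
    moreover have "snd (l s) 0 = s" using n by (simp add: l_def)
    ultimately show ?thesis using \<phi>\<rho>[of s] by simp
  qed
  \<comment> \<open>The transverse coordinate at index \<open>0\<close> recovers the parameter,
    which also shows that distinct points of \<open>T\<close> have distinct transverse
    coordinates.\<close>
  have "inj_on (\<lambda>s. \<rho> (l s)) (cball (y 0) \<epsilon>)"
    by (rule inj_on_inverseI[of _ "\<lambda>w. snd (\<phi> w) 0"]) (use \<phi>T in blast)
  then have "T \<approx> cball (y 0) \<epsilon>" unfolding T_def by (rule inj_on_image_eqpoll_self)
  also have "\<dots> \<approx> (UNIV :: real set)"
    unfolding cball_eq_atLeastAtMost using \<epsilon>(1) by (simp add: closed_interval_eqpoll_reals)
  finally have "T \<approx> (UNIV :: real set)" .
  moreover have "compactin M T"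
    unfolding T_def using _ cont
    by (rule image_compactin) (use \<epsilon>(2) in \<open>auto simp: compactin_subtopology\<close>)
  moreover have "T \<subseteq> U" using \<phi>T unfolding T_def by blast
  moreover have "inj_on (\<lambda>w. snd (\<phi> w)) T"
  proof (rule inj_onI)
    fix v w assume "v \<in> T" "w \<in> T" and eq: "snd (\<phi> v) = snd (\<phi> w)"
    then obtain s t where st: "s \<in> cball (y 0) \<epsilon>" "t \<in> cball (y 0) \<epsilon>" "v = \<rho> (l s)" "w = \<rho> (l t)"
      unfolding T_def by blast
    then have "s = t" using \<phi>T[of s] \<phi>T[of t] eq by metis
    then show "v = w" using st by simp
  qed
  ultimately show ?thesis by (rule that)
qed

theorem theorem1p2:
  fixes M :: "'a topology" and n :: nat and F :: "'a chart set"
  assumes "manifold n M" and "n \<ge> 2" and "foliation n 1 M F"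
  shows "leaves M F \<approx> (UNIV :: real set)"
proof (rule lepoll_antisym)
  note F = \<open>foliation n 1 M F\<close>
  have M: "topspace M \<noteq> {}" "Hausdorff_space M" using assms(1) by (auto simp: manifold_def)
  let ?X = "leaf_topology M F"
  note top = topspace_leaf_topology[OF F]
  let ?leaf = "\<lambda>z. Collect (path_component_of ?X z)"
  have leaves: "leaves M F = ?leaf ` topspace M"
    unfolding leaves_def path_components_of_def top by simp
  \<comment> \<open>Every leaf is the path component of a point, so there are at most as many leaves
    as points.\<close>
  show "leaves M F \<lesssim> (UNIV :: real set)"
    unfolding leaves using image_lepoll manifold_lepoll_reals[OF assms(1)] lepoll_trans by blast
  interpret one_manifold ?X using M(2) F by (rule one_manifold_leaf_topology)
  obtain z where "z \<in> topspace M" using M(1) by blast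
  then obtain U \<phi> where c: "(U, \<phi>) \<in> F" "z \<in> U" using foliation_cover[OF F] by blast
  obtain T where T: "T \<approx> (UNIV :: real set)" "compactin M T" "T \<subseteq> U" "inj_on (\<lambda>w. snd (\<phi> w)) T"
    by (rule compact_transversal[OF F c assms(2)])
  \<comment> \<open>Compactness is used in the manifold topology only; closedness is what carries
    over to the finer leaf topology.\<close>
  have "closedin M T" using M(2) T(2) by (rule compactin_imp_closedin)
  then have "closedin ?X T"
    using openin_leaf_topology[OF F] unfolding closedin_def top by blast
  \<comment> \<open>A plaque has constant transverse coordinate, which is injective on
    \<open>T\<close>, so it meets \<open>T\<close> in at most one point.\<close>
  moreover have "\<exists>P. openin ?X P \<and> P \<inter> T = {w}" if w: "w \<in> T" for w
  proof -
    have "w \<in> U" using w T(3) by blast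
    then obtain J where J: "w \<in> J" "J \<subseteq> {v \<in> U. snd (\<phi> v) = snd (\<phi> w)}" "J \<in> plaques M F"
      by (rule plaque_nbhd[OF F c(1)])
    have "J \<inter> T = {w}" using J(1,2) w inj_onD[OF T(4)] by blast
    moreover have "openin ?X J"
      unfolding leaf_topology_def using J(3) by (rule topology_generated_by_Basis)
    ultimately show ?thesis by blast
  qed
  ultimately have countable: "countable (?leaf x \<inter> T)" for x
    by (rule countable_path_component_Int)
  have TM: "T \<subseteq> topspace M" using T(2) by (rule compactin_subset_topspace)
  \<comment> \<open>Points of \<open>T\<close> with the same leaf lie in the intersection of this
    leaf with \<open>T\<close>.\<close>
  have fib: "countable {t \<in> T. ?leaf t = L}" for L
  proof (cases "{t \<in> T. ?leaf t = L} = {}")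
    case False
    then obtain x where "?leaf x = L" by blast
    moreover have "t \<in> ?leaf t" if "t \<in> T" for t
      using that TM by (auto simp: path_component_of_refl top)
    ultimately have "{t \<in> T. ?leaf t = L} \<subseteq> ?leaf x \<inter> T" by blast
    then show ?thesis using countable countable_subset by blast
  next
    case True
    show ?thesis unfolding True by simp
  qed
  have "uncountable T" using T(1) uncountable_UNIV_real countable_eqpoll eqpoll_sym by blast
  have "(UNIV :: real set) \<approx> T" using T(1) by (rule eqpoll_sym)
  also have "T \<lesssim> ?leaf ` T" using \<open>uncountable T\<close> fib by (rule countable_fibres_lepoll)
  also have "\<dots> \<lesssim> leaves M F" unfolding leaves using TM by (intro subset_imp_lepoll image_mono)
  finally show "(UNIV :: real set) \<lesssim> leaves M F" .
qed

end
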